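(* Let $\mathbf{P}$ be a convex hexagon all of whose vertices lie in $\mathbb{Z}^2$, whose opposite sides are parallel, and whose sides have slopes $0$, $1$ and $\infty$. The lattice points on the boundary partition the sides into elementary segments; let $p_1,q_1,r_1,p_2,q_2,r_2$ be the numbers of these elementary segments on the six sides in cyclic order, and set $$N = p_1q_1+q_1r_1+r_1p_2+p_2q_2+q_2r_2+r_2p_1+p_1r_1+q_1p_2+r_1q_2+p_2r_2+q_2p_1+r_2q_1 .$$ Then all orbits of the symplectic billiard in $\mathbf{P}$ are periodic, and the periods do not exceed $4N$.
   Context: Symplectic billiard. Let $\mathbf{P}$ be a convex polygon with vertices $P_1,\dots,P_n$ in counterclockwise order, and $v_i=P_{i+1}-P_i$ (indices cyclic). Write $[\cdot,\cdot]$ for the determinant of two plane vectors and $v_i\times v_j$ for the set of oriented chords $(x,y)$ with tail $x$ in the interior of side $P_iP_{i+1}$ and head $y$ in the interior of side $P_jP_{j+1}$. The symplectic billiard map is $T(x,y)=(y,z)$, where $z\neq x$ is the second intersection point with the boundary of $\mathbf{P}$ of the line through $x$ parallel to the side containing $y$. Iteration is undefined once the head is a vertex of $\mathbf{P}$. The (reduced) phase space $\Phi_{\mathbf{P}}$ is the union of the sets $v_i\times v_j$ with $[v_i,v_j]>0$ (in particular $v_i,v_j$ are not parallel); $T$ preserves the condition $[v_i,v_j]>0$. "All orbits" refers to phase points all of whose forward and backward iterates under $T$ are defined. *)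

theory Defs
  imports "HOL-Analysis.Analysis"
begin

type_synonym point = "real \<times> real"
type_synonym chord = "point \<times> point"

definition bracket :: "point \<Rightarrow> point \<Rightarrow> real" where
  "bracket u v = fst u * snd v - snd u * fst v"

text \<open>A polygon is the list of its vertices; indices are read cyclically.\<close>

definition vertex :: "point list \<Rightarrow> nat \<Rightarrow> point" where
  "vertex P i = P ! (i mod length P)"

definition side_vec :: "point list \<Rightarrow> nat \<Rightarrow> point" where
  "side_vec P i = vertex P (Suc i) - vertex P i"

definition side :: "point list \<Rightarrow> nat \<Rightarrow> point set" where
  "side P i = closed_segment (vertex P i) (vertex P (Suc i))"

definition side_interior :: "point list \<Rightarrow> nat \<Rightarrow> point set" where
  "side_interior P i = open_segment (vertex P i) (vertex P (Suc i))"

definition polygon_boundary :: "point list \<Rightarrow> point set" where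
  "polygon_boundary P = (\<Union>i<length P. side P i)"

text \<open>Convexity together with the counterclockwise order: every vertex that is not an endpoint of
  a directed side lies strictly to the left of it. In particular no angle is straight, so that the
  listed sides are the genuine sides.\<close>

definition convex_polygon :: "point list \<Rightarrow> bool" where
  "convex_polygon P \<longleftrightarrow> length P \<ge> 3 \<and>
     (\<forall>i<length P. \<forall>j<length P. j \<noteq> i \<and> j \<noteq> Suc i mod length P \<longrightarrow>
        bracket (side_vec P i) (vertex P j - vertex P i) > 0)"

definition slope :: "point \<Rightarrow> ereal" where
  "slope v = (if fst v = 0 then \<infinity> else ereal (snd v / fst v))"

definition lattice :: "point set" where
  "lattice = \<int> \<times> \<int>"

definition elementary_segments :: "point list \<Rightarrow> nat \<Rightarrow> point set set" where
  "elementary_segments P i =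
     {closed_segment a b | a b. a \<in> side P i \<inter> lattice \<and> b \<in> side P i \<inter> lattice \<and>
        a \<noteq> b \<and> open_segment a b \<inter> lattice = {}}"

text \<open>The chord with tail \<open>x\<close> and head \<open>y\<close> is the pair \<open>(x, y)\<close>.\<close>

definition chords :: "point list \<Rightarrow> nat \<Rightarrow> nat \<Rightarrow> chord set" where
  "chords P i j = side_interior P i \<times> side_interior P j"

definition phase_space :: "point list \<Rightarrow> chord set" where
  "phase_space P =
     \<Union>{chords P i j | i j. i < length P \<and> j < length P \<and> bracket (side_vec P i) (side_vec P j) > 0}"

text \<open>Only the values on the phase space matter. There the point \<open>z\<close> exists and is unique; it may be
  a vertex, in which case the value lies outside the phase space.\<close>

definition symplectic_billiard :: "point list \<Rightarrow> chord \<Rightarrow> chord" where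
  "symplectic_billiard P = (\<lambda>(x, y). (y,
     THE z. z \<noteq> x \<and> z \<in> polygon_boundary P \<and>
       (\<exists>j<length P. y \<in> side_interior P j \<and> (\<exists>t. z = x + t *\<^sub>R side_vec P j))))"

text \<open>All forward and backward iterates of \<open>c\<close> are defined: \<open>c\<close> lies on a bi-infinite trajectory that
  stays in the phase space. (If \<open>c\<close> is in the phase space, the only way for its image to leave it is
  that the head of the image is a vertex; likewise backwards with the tail. Backward iterates are
  unique because the map is injective on the phase space.)\<close>

definition has_full_orbit :: "point list \<Rightarrow> chord \<Rightarrow> bool" where
  "has_full_orbit P c \<longleftrightarrow> (\<exists>\<sigma> :: int \<Rightarrow> chord. \<sigma> 0 = c \<and>
     (\<forall>k. \<sigma> k \<in> phase_space P \<and> symplectic_billiard P (\<sigma> k) = \<sigma> (k + 1)))"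

definition periodic_point :: "('a \<Rightarrow> 'a) \<Rightarrow> 'a \<Rightarrow> bool" where
  "periodic_point f c \<longleftrightarrow> (\<exists>k>0. (f ^^ k) c = c)"

definition period :: "('a \<Rightarrow> 'a) \<Rightarrow> 'a \<Rightarrow> nat" where
  "period f c = (LEAST k. k > 0 \<and> (f ^^ k) c = c)"

end

theory Submission
  imports Defs
begin

text \<open>Up to orientation the sides point along lattice vectors $e_0, e_1, \dots$ with
  $e_{i+2} = e_{i+1} - e_i$, and side $i$ is $n_i e_i$ for a positive integer $n_i$, the number of its
  elementary segments. Measure points of a side by their distance $u$ from its first vertex in units of
  $e_i$. Projecting along $e_j$ from one side to another maps boundary lattice points to boundary
  lattice points and reverses the boundary orientation, so it acts by $u \mapsto -u$ modulo 1. Hence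
  $T$ acts on the residues modulo 1 of (tail, head) by $(u, v) \mapsto (v, -u)$, which has order 4. An
  orbit of $T^4$ therefore lives in the set of phase points with two prescribed residues. A side
  contains at most $n_i$ points with a given residue, so this set has at most $N$ elements. As $T$ is
  injective, every $T^4$-orbit closes up after at most $N$ steps.\<close>

section \<open>Determinants, lattice points and cyclic indices\<close>

lemma bracket_simps:
  "bracket (u + u') v = bracket u v + bracket u' v"
  "bracket u (v + v') = bracket u v + bracket u v'"
  "bracket (u - u') v = bracket u v - bracket u' v"
  "bracket u (v - v') = bracket u v - bracket u v'"
  "bracket (- u) v = - bracket u v"
  "bracket u (- v) = - bracket u v"
  "bracket (a *\<^sub>R u) v = a * bracket u v"
  "bracket u (a *\<^sub>R v) = a * bracket u v"
  "bracket u u = 0"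
  "bracket 0 v = 0"
  "bracket u 0 = 0"
  by (simp_all add: bracket_def algebra_simps)

lemma bracket_commute: "bracket u v = - bracket v u"
  by (simp add: bracket_def)

lemma lattice_iff: "p \<in> lattice \<longleftrightarrow> fst p \<in> \<int> \<and> snd p \<in> \<int>"
  by (cases p) (simp add: lattice_def)

lemma lattice_add: "p \<in> lattice \<Longrightarrow> q \<in> lattice \<Longrightarrow> p + q \<in> lattice"
  and lattice_diff: "p \<in> lattice \<Longrightarrow> q \<in> lattice \<Longrightarrow> p - q \<in> lattice"
  and lattice_scaleR: "a \<in> \<int> \<Longrightarrow> p \<in> lattice \<Longrightarrow> a *\<^sub>R p \<in> lattice"
  and bracket_Ints: "p \<in> lattice \<Longrightarrow> q \<in> lattice \<Longrightarrow> bracket p q \<in> \<int>"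
  by (auto simp: lattice_iff bracket_def)

text \<open>Modulo 6, \<open>5 * j\<close> stands for \<open>- j\<close>, so the witness is the
  cyclic offset from \<open>j\<close> to \<open>i\<close>. It allows every other side to be
  described relative to a fixed side \<open>j\<close>.\<close>

lemma mod6_less_cases:
  fixes i j :: nat
  obtains m where "m < 6" "(j + m) mod 6 = i mod 6"
proof
  show "(i + 5 * j) mod 6 < 6" by simp
  have "(j + (i + 5 * j) mod 6) mod 6 = (j + (i + 5 * j)) mod 6" by (rule mod_add_right_eq)
  also have "\<dots> = (i + 6 * j) mod 6" by (simp add: algebra_simps)
  finally show "(j + (i + 5 * j) mod 6) mod 6 = i mod 6" by simp
qed

lemma less_6_cases:
  fixes m :: nat
  assumes "m < 6"
  obtains "m = 0" | "m = 1" | "m = 2" | "m = 3" | "m = 4" | "m = 5"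
  using assms by linarith

text \<open>Kept abstract so that it covers \<open>hex_dir\<close> and also its shifts: the first
  side of \<open>P\<close> may point in any of the six directions.\<close>

locale hexagonal_directions =
  fixes e :: "nat \<Rightarrow> point"
  assumes e_rec: "\<And>i. e (i + 2) = e (i + 1) - e i"
    and e_0_1: "bracket (e 0) (e 1) = 1"
begin

lemma bracket_e_1: "bracket (e i) (e (i + 1)) = 1"
proof (induction i)
  case 0 show ?case using e_0_1 by simp
next
  case (Suc i)
  have "e (Suc i + 1) = e (Suc i) - e i" using e_rec[of i] by simp
  with Suc show ?case by (simp add: bracket_simps bracket_commute[of "e (Suc i)"])
qed

lemma e_3: "e (i + 3) = - e i"
  using e_rec[of i] e_rec[of "i + 1"] by (simp add: add.assoc numeral_eq_Suc)

lemma e_shift: "e (i + 4) = - e (i + 1)" "e (i + 5) = e i - e (i + 1)" "e (i + 6) = e i"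
  using e_3[of "i + 1"] e_3[of "i + 2"] e_3[of "i + 3"] e_3[of i] e_rec[of i]
  by (simp_all add: add.assoc add.commute[of i])

lemma e_mod: "e (i mod 6) = e i"
proof -
  have "e (k + 6 * q) = e k" for k q
    proof (induction q)
    case (Suc q)
    then show ?case using e_shift(3)[of "k + 6 * q"] by (simp add: algebra_simps)
  qed simp
  from this[of "i mod 6" "i div 6"] show ?thesis by simp
qed

lemma e_nonzero: "e i \<noteq> 0"
  using bracket_e_1[of i] by (auto simp: bracket_simps)

end

text \<open>Convexity survives here only as the counterclockwise turning of \<open>e\<close>
  together with the positivity of \<open>n\<close>. The lengths \<open>n\<close> are indexed by all
  naturals; their period 6 is derived in \<open>n_mod\<close>.\<close>

locale lattice_hexagon = hexagonal_directions e for e +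
  fixes P :: "point list" and n :: "nat \<Rightarrow> nat"
  assumes length_P: "length P = 6"
    and e_lattice: "\<And>i. e i \<in> lattice"
    and vertex_lattice: "\<And>i. vertex P i \<in> lattice"
    and vertex_Suc: "\<And>i. vertex P (Suc i) = vertex P i + real (n i) *\<^sub>R e i"
    and n_pos: "\<And>i. n i > 0"
begin

lemma vertex_mod: "vertex P (i mod 6) = vertex P i"
  by (simp add: vertex_def length_P)

lemma side_vec_eq: "side_vec P i = real (n i) *\<^sub>R e i"
  by (simp add: side_vec_def vertex_Suc)

lemma n_mod: "n (i mod 6) = n i"
proof -
  have "vertex P (Suc (i mod 6)) = vertex P (Suc i)"
    by (simp add: vertex_def length_P mod_Suc_eq)
  then have "real (n (i mod 6)) *\<^sub>R e i = real (n i) *\<^sub>R e i"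
    using vertex_Suc[of i] vertex_Suc[of "i mod 6"] by (simp add: vertex_mod e_mod)
  then show ?thesis by (simp add: e_nonzero)
qed

section \<open>Coordinates along the sides and in the affine frame of one side\<close>

definition pt :: "nat \<Rightarrow> real \<Rightarrow> point" where
  "pt i u = vertex P i + u *\<^sub>R e i"

lemma pt_mod: "pt (i mod 6) = pt i"
  by (simp add: pt_def fun_eq_iff vertex_mod e_mod)

lemma pt_cong: "i mod 6 = j mod 6 \<Longrightarrow> pt i = pt j"
  by (metis pt_mod)

lemma n_cong: "i mod 6 = j mod 6 \<Longrightarrow> n i = n j"
  by (metis n_mod)

lemma pt_inject [simp]: "pt i u = pt i v \<longleftrightarrow> u = v"
  by (simp add: pt_def e_nonzero)

lemma closed_segment_pt: "u \<le> v \<Longrightarrow> closed_segment (pt i u) (pt i v) = pt i ` {u..v}"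
proof -
  assume "u \<le> v"
  have "closed_segment (pt i u) (pt i v) = pt i ` closed_segment u v"
    using closed_segment_linear_image[OF bounded_linear.linear[OF bounded_linear_scaleR_left], of u "e i" v]
    by (simp add: pt_def closed_segment_translation image_image)
  with \<open>u \<le> v\<close> show ?thesis by (simp add: closed_segment_eq_real_ivl)
qed

lemma open_segment_pt: "u \<le> v \<Longrightarrow> open_segment (pt i u) (pt i v) = pt i ` {u<..<v}"
  by (force simp: open_segment_def closed_segment_pt)

lemma side_eq: "side P i = pt i ` {0..real (n i)}"
  using closed_segment_pt[of 0 "real (n i)" i] by (simp add: side_def vertex_Suc pt_def)

lemma side_interior_eq: "side_interior P i = pt i ` {0<..<real (n i)}"
  using open_segment_pt[of 0 "real (n i)" i] by (simp add: side_interior_def vertex_Suc pt_def)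

text \<open>In these affine coordinates the chords parallel to side $j$ are the lines of constant second
  coordinate.\<close>

definition frame :: "nat \<Rightarrow> real \<Rightarrow> real \<Rightarrow> point" where
  "frame j a b = vertex P j + a *\<^sub>R e j + b *\<^sub>R e (j + 1)"

lemma frame_eqD:
  assumes "frame j a b = frame j a' b'"
  shows "a = a' \<and> b = b'"
proof -
  have "bracket (e j) (frame j a b - frame j a' b') = b - b'"
       "bracket (frame j a b - frame j a' b') (e (j + 1)) = a - a'"
    using bracket_e_1[of j] by (simp_all add: frame_def bracket_simps)
  then show ?thesis using assms by (simp add: bracket_simps)
qed

lemma frame_inject [simp]: "frame j a b = frame j a' b' \<longleftrightarrow> a = a' \<and> b = b'"
  using frame_eqD by blast

lemma frame_add: "frame j a b + t *\<^sub>R e j = frame j (a + t) b"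
  by (simp add: frame_def algebra_simps)

text \<open>With all sides written in the basis \<open>e j\<close>, \<open>e (j + 1)\<close> for
  arbitrary \<open>j\<close>, later case analyses can treat any side as the bottom side of the
  hexagon.\<close>

lemma vertex_step:
  "vertex P (j + 1) = vertex P j + real (n j) *\<^sub>R e j"
  "vertex P (j + 2) = vertex P (j + 1) + real (n (j + 1)) *\<^sub>R e (j + 1)"
  "vertex P (j + 3) = vertex P (j + 2) + real (n (j + 2)) *\<^sub>R (e (j + 1) - e j)"
  "vertex P (j + 4) = vertex P (j + 3) - real (n (j + 3)) *\<^sub>R e j"
  "vertex P (j + 5) = vertex P (j + 4) - real (n (j + 4)) *\<^sub>R e (j + 1)"
  "vertex P j = vertex P (j + 5) + real (n (j + 5)) *\<^sub>R (e j - e (j + 1))"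
proof -
  have "vertex P (j + 6) = vertex P j" by (simp add: vertex_def length_P)
  then show "vertex P j = vertex P (j + 5) + real (n (j + 5)) *\<^sub>R (e j - e (j + 1))"
    using vertex_Suc[of "j + 5"] by (simp only: e_shift) (simp add: eval_nat_numeral)
  show "vertex P (j + 4) = vertex P (j + 3) - real (n (j + 3)) *\<^sub>R e j"
    using vertex_Suc[of "j + 3"] by (simp only: e_3) (simp add: eval_nat_numeral)
  show "vertex P (j + 5) = vertex P (j + 4) - real (n (j + 4)) *\<^sub>R e (j + 1)"
    using vertex_Suc[of "j + 4"] by (simp only: e_shift) (simp add: eval_nat_numeral)
  show "vertex P (j + 3) = vertex P (j + 2) + real (n (j + 2)) *\<^sub>R (e (j + 1) - e j)"
    using vertex_Suc[of "j + 2"] by (simp only: e_rec) (simp add: eval_nat_numeral)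
qed (simp_all add: vertex_Suc)

lemma vertex_frame_backwards:
  "vertex P (j + 5) = frame j (- real (n (j + 5))) (n (j + 5))"
  "vertex P (j + 4) = frame j (- real (n (j + 5))) (n (j + 5) + n (j + 4))"
proof -
  show 5: "vertex P (j + 5) = frame j (- real (n (j + 5))) (n (j + 5))"
    using vertex_step(6)[of j] by (simp add: frame_def algebra_simps)
  show "vertex P (j + 4) = frame j (- real (n (j + 5))) (n (j + 5) + n (j + 4))"
    using vertex_step(5)[of j] 5 by (simp add: frame_def algebra_simps)
qed

lemma vertex_frame_forwards:
  "vertex P (j + 1) = frame j (n j) 0"
  "vertex P (j + 2) = frame j (n j) (n (j + 1))"
  "vertex P (j + 3) = frame j (real (n j) - n (j + 2)) (n (j + 1) + n (j + 2))"
  "vertex P (j + 4) = frame j (real (n j) - n (j + 2) - n (j + 3)) (n (j + 1) + n (j + 2))"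
  by (simp_all only: vertex_step(1-4)) (simp_all add: frame_def algebra_simps)

text \<open>Vertex \<open>j + 4\<close> is reached from vertex \<open>j\<close> both ways around the
  hexagon; the two results must have the same frame coordinates.\<close>

lemma closing:
  "real (n (j + 1)) + n (j + 2) = real (n (j + 4)) + n (j + 5)"
  "real (n j) + n (j + 5) = real (n (j + 2)) + n (j + 3)"
  using vertex_frame_forwards(4)[of j] vertex_frame_backwards(2)[of j] by simp_all

lemma pt_frame:
  fixes u :: real
  shows "pt j u = frame j u 0"
  "pt (j + 1) u = frame j (n j) u"
  "pt (j + 2) u = frame j (n j - u) (n (j + 1) + u)"
  "pt (j + 3) u = frame j (real (n j) - n (j + 2) - u) (n (j + 1) + n (j + 2))"
  "pt (j + 4) u = frame j (- real (n (j + 5))) (n (j + 5) + n (j + 4) - u)"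
  "pt (j + 5) u = frame j (u - n (j + 5)) (n (j + 5) - u)"
  by (simp_all only: pt_def vertex_frame_forwards(1-3) vertex_frame_backwards e_rec e_3 e_shift)
    (simp_all add: frame_def algebra_simps)

section \<open>The boundary and the billiard map in frame coordinates\<close>

lemma polygon_boundary_cases:
  assumes "z \<in> polygon_boundary P"
  obtains m and v :: real where "m < 6" "0 \<le> v" "v \<le> n (j + m)" "z = pt (j + m) v"
proof -
  from assms obtain i and v :: real where "v \<ge> 0" "v \<le> n i" "z = pt i v"
    by (auto simp: polygon_boundary_def side_eq)
  moreover obtain m where "m < 6" "(j + m) mod 6 = i mod 6" by (rule mod6_less_cases)
  moreover from this have "pt (j + m) = pt i" "n (j + m) = n i" by (auto intro: pt_cong n_cong)
  ultimately show thesis using that by auto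
qed

lemma pt_in_polygon_boundary: "0 \<le> v \<Longrightarrow> v \<le> real (n i) \<Longrightarrow> pt i v \<in> polygon_boundary P"
proof -
  assume "0 \<le> v" "v \<le> real (n i)"
  then have "pt (i mod 6) v \<in> side P (i mod 6)" by (auto simp: side_eq n_mod)
  then show ?thesis by (auto simp: polygon_boundary_def length_P pt_mod intro!: bexI[of _ "i mod 6"])
qed

text \<open>In the frame of side \<open>i\<close>, the other sides have positive second coordinate
  except at the endpoints of side \<open>i\<close>, which the strict bounds on \<open>u\<close>
  exclude. The second point may be a vertex, since the head of an image is at first only known to
  lie on a closed side.\<close>

lemma side_interior_pt_unique:
  fixes u u' :: real
  assumes "0 < u" "u < n i" "0 \<le> u'" "u' \<le> n i'" "pt i u = pt i' u'"
  shows "i mod 6 = i' mod 6 \<and> u = u'"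
proof -
  obtain m where m: "m < 6" "(i + m) mod 6 = i' mod 6" by (rule mod6_less_cases)
  have eq: "frame i u 0 = pt (i + m) u'" and u': "u' \<le> n (i + m)"
    using assms pt_cong[OF m(2)] n_cong[OF m(2)] by (auto simp: pt_frame(1)[symmetric])
  have pos: "real (n (i + 1)) > 0" "real (n (i + 2)) > 0" "real (n (i + 5)) > 0"
    using n_pos by auto
  from m(1) have "m = 0"
    using eq u' assms(1-3) pos
    by (cases rule: less_6_cases) (simp_all only: pt_frame(2-6) frame_inject, auto)
  then show ?thesis using m eq by (auto simp: pt_frame)
qed

text \<open>Sides \<open>j + 4\<close> and \<open>j + 5\<close> climb one flank of the hexagon above
  side \<open>j\<close>, sides \<open>j + 1\<close> and \<open>j + 2\<close> the other, and a line
  parallel to side \<open>j\<close> crosses each flank once. The equivalence gives both the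
  existence and the uniqueness that the description operator in the map requires; it also serves to
  prove injectivity.\<close>

lemma second_intersection:
  fixes u :: real
  assumes d: "d \<in> {4, 5}" and u: "0 < u" "u < n (j + d)"
  obtains k and w :: real where "0 \<le> w" "w \<le> n k" "u + w \<in> \<int>"
    "\<And>z. z \<noteq> pt (j + d) u \<and> z \<in> polygon_boundary P \<and> (\<exists>t. z = pt (j + d) u + t *\<^sub>R side_vec P j)
        \<longleftrightarrow> z = pt k w"
proof -
  define x where "x = pt (j + d) u"
  define n0 n1 n2 n3 n4 n5 where n_defs: "n0 = real (n j)" "n1 = real (n (j + 1))"
    "n2 = real (n (j + 2))" "n3 = real (n (j + 3))" "n4 = real (n (j + 4))" "n5 = real (n (j + 5))"
  have pos: "n0 > 0" "n1 > 0" "n2 > 0" "n3 > 0" "n4 > 0" "n5 > 0"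
    using n_pos by (auto simp: n_defs)
  have cl: "n1 + n2 = n4 + n5" "n0 + n5 = n2 + n3"
    using closing[of j] by (auto simp: n_defs)
  have ints: "n1 \<in> \<int>" "n4 \<in> \<int>" "n5 \<in> \<int>" by (auto simp: n_defs)
  note fr = pt_frame[of j, folded n_defs]
  \<comment> \<open>The first disjunct places the tail on side \<open>j + 4\<close>, the second on
    side \<open>j + 5\<close>; \<open>b\<close> is its height above side \<open>j\<close>.\<close>
  obtain a b where x: "x = frame j a b"
    and ab: "a = - n5 \<and> n5 < b \<and> b < n4 + n5 \<or> a = - b \<and> 0 < b \<and> b < n5"
    and ub: "u + b \<in> \<int>"
    using d u ints by (auto simp: x_def fr n_defs[symmetric])
  have b: "0 < b" "b < n1 + n2" using ab cl pos by auto
  \<comment> \<open>Side \<open>j + 1\<close> covers the heights up to \<open>n1\<close>, side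
    \<open>j + 2\<close> those from \<open>n1\<close> to \<open>n1 + n2\<close>. At height
    \<open>n1\<close> they share a vertex, which is assigned to \<open>j + 1\<close>.\<close>
  define k w where "k = (if b \<le> n1 then j + 1 else j + 2)" and "w = (if b \<le> n1 then b else b - n1)"
  define a' where "a' = (if b \<le> n1 then n0 else n0 + n1 - b)"
  have pk: "pt k w = frame j a' b"
    by (auto simp: k_def w_def a'_def fr
        simp del: One_nat_def add_Suc_right add_2_eq_Suc' add_2_eq_Suc)
  have w: "0 \<le> w" "w \<le> n k"
    using b by (auto simp: k_def w_def n_defs)
  have uw: "u + w \<in> \<int>"
  proof -
    have "u + b - n1 \<in> \<int>" using ub ints(1) by (rule Ints_diff)
    with ub show ?thesis by (auto simp: w_def algebra_simps)
  qed
  have ne: "a' \<noteq> a" using ab b pos cl by (auto simp: a'_def split: if_splits)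
  have line: "(\<exists>t. z = x + t *\<^sub>R side_vec P j) \<longleftrightarrow> (\<exists>c. z = frame j c b)" for z
  proof
    assume "\<exists>t. z = x + t *\<^sub>R side_vec P j"
    then show "\<exists>c. z = frame j c b" by (auto simp: x side_vec_eq frame_add)
  next
    assume "\<exists>c. z = frame j c b"
    then obtain c where "z = frame j c b" by blast
    then have "z = x + ((c - a) / n0) *\<^sub>R side_vec P j"
      using pos by (simp add: x side_vec_eq frame_add n_defs)
    then show "\<exists>t. z = x + t *\<^sub>R side_vec P j" ..
  qed
  have "z \<noteq> x \<and> z \<in> polygon_boundary P \<and> (\<exists>t. z = x + t *\<^sub>R side_vec P j) \<longleftrightarrow> z = pt k w" for z
  proof
    assume "z = pt k w"
    then show "z \<noteq> x \<and> z \<in> polygon_boundary P \<and> (\<exists>t. z = x + t *\<^sub>R side_vec P j)"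
      unfolding line using pt_in_polygon_boundary[OF w] ne by (auto simp: pk x)
  next
    assume z: "z \<noteq> x \<and> z \<in> polygon_boundary P \<and> (\<exists>t. z = x + t *\<^sub>R side_vec P j)"
    then obtain c where c: "z = frame j c b" unfolding line by blast
    with z have "c \<noteq> a" by (auto simp: x)
    obtain m and v :: real where "m < 6" "0 \<le> v" "v \<le> n (j + m)" "z = pt (j + m) v"
      using z polygon_boundary_cases[of z j] by blast
    \<comment> \<open>One disjunct per side. The bounds on \<open>b\<close> exclude sides
      \<open>j\<close> and \<open>j + 3\<close>, and on the flank of the tail the only point at
      height \<open>b\<close> is the tail, excluded by \<open>c \<noteq> a\<close>.\<close>
    then have "b = 0 \<or> c = n0 \<and> b \<le> n1 \<or> c = n0 + n1 - b \<and> n1 \<le> b \<or> b = n1 + n2 \<or>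
      c = - n5 \<and> n5 \<le> b \<or> c = - b \<and> b \<le> n5"
      unfolding c
      by (cases rule: less_6_cases)
        (auto simp: fr n_defs[symmetric]
        simp del: One_nat_def add_Suc_right add_2_eq_Suc' add_2_eq_Suc)
    then have "c = a'"
      using \<open>c \<noteq> a\<close> ab b unfolding a'_def by (elim disjE conjE) (simp_all split: if_splits)
    then show "z = pt k w" by (simp add: c pk)
  qed
  with that[OF w uw] show thesis by (simp add: x_def)
qed

text \<open>The bracket of \<open>e (j + d)\<close> with \<open>e j\<close> vanishes for
  \<open>d\<close> = 0, 3, is -1 for \<open>d\<close> = 1, 2 and is 1 for \<open>d\<close> = 4,
  5.\<close>

lemma phase_space_cases:
  assumes "c \<in> phase_space P"
  obtains j d and u v :: real where "j < 6" "d \<in> {4, 5}" "0 < u" "u < n (j + d)" "0 < v" "v < n j"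
    "c = (pt (j + d) u, pt j v)"
proof -
  from assms obtain i j where ij: "i < 6" "j < 6" "c \<in> chords P i j"
    "bracket (side_vec P i) (side_vec P j) > 0"
    by (auto simp: phase_space_def length_P)
  obtain d where d: "d < 6" "(j + d) mod 6 = i mod 6" by (rule mod6_less_cases)
  have "e (j + d) = e i" using d(2) e_mod by metis
  then have *: "bracket (e (j + d)) (e j) > 0"
    using ij(4) n_pos by (auto simp: side_vec_eq bracket_simps zero_less_mult_iff)
  have "bracket (e j) (e (j + 1)) = 1" "bracket (e (j + 1)) (e j) = - 1"
    using bracket_e_1[of j] bracket_commute[of "e (j + 1)" "e j"] by simp_all
  with d(1) * have "d \<in> {4, 5}"
    by (cases rule: less_6_cases)
      (auto simp: e_rec e_3 e_shift bracket_simps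
        simp del: One_nat_def add_Suc_right add_2_eq_Suc' add_2_eq_Suc)
  moreover from ij(3) obtain u v :: real where "0 < u" "u < n i" "0 < v" "v < n j" "c = (pt i u, pt j v)"
    by (auto simp: chords_def side_interior_eq)
  ultimately show thesis
    using that ij(2) pt_cong[OF d(2)] n_cong[OF d(2)] by simp
qed

text \<open>Open sides are disjoint, so the head determines the side over which the definition
  quantifies.\<close>

lemma symplectic_billiard_eq:
  fixes v :: real
  assumes "j < 6" "0 < v" "v < n j"
  shows "symplectic_billiard P (x, pt j v) = (pt j v,
    THE z. z \<noteq> x \<and> z \<in> polygon_boundary P \<and> (\<exists>t. z = x + t *\<^sub>R side_vec P j))"
proof -
  have "i = j" if i: "i < 6" "pt j v \<in> side_interior P i" for i
  proof -
    from i(2) obtain u :: real where "0 < u" "u < n i" "pt j v = pt i u" by (auto simp: side_interior_eq)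
    then have "j mod 6 = i mod 6" using side_interior_pt_unique[OF assms(2,3), of u i] by simp
    with i(1) assms(1) show ?thesis by simp
  qed
  moreover have "pt j v \<in> side_interior P j" using assms by (simp add: side_interior_eq)
  ultimately have *: "(\<exists>i<length P. pt j v \<in> side_interior P i \<and> Q i) \<longleftrightarrow> Q j" for Q
    unfolding length_P using assms(1) by blast
  show ?thesis unfolding symplectic_billiard_def prod.case * ..
qed

lemma symplectic_billiard_step:
  fixes u v :: real
  assumes "d \<in> {4, 5}" "0 < u" "u < n (j + d)" "j < 6" "0 < v" "v < n j"
  obtains k and w :: real where "0 \<le> w" "w \<le> n k" "u + w \<in> \<int>"
    "symplectic_billiard P (pt (j + d) u, pt j v) = (pt j v, pt k w)"
    "\<And>z. z \<noteq> pt (j + d) u \<and> z \<in> polygon_boundary P \<and> (\<exists>t. z = pt (j + d) u + t *\<^sub>R side_vec P j)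
        \<longleftrightarrow> z = pt k w"
proof -
  obtain k and w :: real where w: "0 \<le> w" "w \<le> n k" "u + w \<in> \<int>"
    and z: "\<And>z. z \<noteq> pt (j + d) u \<and> z \<in> polygon_boundary P \<and>
      (\<exists>t. z = pt (j + d) u + t *\<^sub>R side_vec P j) \<longleftrightarrow> z = pt k w"
    by (rule second_intersection[OF assms(1-3)]) (rule that)
  have "symplectic_billiard P (pt (j + d) u, pt j v) = (pt j v, pt k w)"
    unfolding symplectic_billiard_eq[OF assms(4-6)] z by simp
  from that[OF w this z] show thesis .
qed

text \<open>The common image fixes the head, hence the side \<open>j\<close>, and the point
  \<open>z\<close>. Both tails are boundary points other than \<open>z\<close> on the line through
  \<open>z\<close> parallel to side \<open>j\<close>, and this line meets the boundary in only two
  points.\<close>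

lemma symplectic_billiard_inj_on: "inj_on (symplectic_billiard P) (phase_space P)"
proof
  fix c c' assume c: "c \<in> phase_space P" and c': "c' \<in> phase_space P"
    and eq: "symplectic_billiard P c = symplectic_billiard P c'"
  from c obtain j d and u v :: real where 1: "d \<in> {4, 5}" "0 < u" "u < n (j + d)" "j < 6" "0 < v" "v < n j"
    "c = (pt (j + d) u, pt j v)" by (rule phase_space_cases)
  from c' obtain j' d' and u' v' :: real where 2: "d' \<in> {4, 5}" "0 < u'" "u' < n (j' + d')" "j' < 6" "0 < v'"
    "v' < n j'" "c' = (pt (j' + d') u', pt j' v')" by (rule phase_space_cases)
  let ?x = "pt (j + d) u" and ?x' = "pt (j' + d') u'"
  obtain k and w :: real where 3: "symplectic_billiard P c = (pt j v, pt k w)"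
    "\<And>z. z \<noteq> ?x \<and> z \<in> polygon_boundary P \<and> (\<exists>t. z = ?x + t *\<^sub>R side_vec P j) \<longleftrightarrow> z = pt k w"
    by (rule symplectic_billiard_step[OF 1(1-6), folded 1(7)]) (rule that)
  obtain k' and w' :: real where 4: "symplectic_billiard P c' = (pt j' v', pt k' w')"
    "\<And>z. z \<noteq> ?x' \<and> z \<in> polygon_boundary P \<and> (\<exists>t. z = ?x' + t *\<^sub>R side_vec P j') \<longleftrightarrow> z = pt k' w'"
    by (rule symplectic_billiard_step[OF 2(1-6), folded 2(7)]) (rule that)
  have pts: "pt j v = pt j' v'" "pt k w = pt k' w'" using eq 3(1) 4(1) by auto
  have jj: "j = j'" using side_interior_pt_unique[OF 1(5,6) _ _ pts(1)] 1(4) 2(4-6) by simp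
  obtain t where t: "pt k w = ?x + t *\<^sub>R side_vec P j" using 3(2)[of "pt k w"] by blast
  obtain t' where t': "pt k w = ?x' + t' *\<^sub>R side_vec P j" and ne: "pt k w \<noteq> ?x'"
    using 4(2)[of "pt k w"] pts(2) jj by blast
  have "?x' = ?x + (t - t') *\<^sub>R side_vec P j" using t t' by (simp add: algebra_simps)
  moreover have "?x' \<in> polygon_boundary P" using 2 by (intro pt_in_polygon_boundary) auto
  ultimately have "?x = ?x'" using 3(2)[of ?x'] ne by auto
  then show "c = c'" using 1(7) 2(7) pts(1) by simp
qed

section \<open>Residues modulo 1, counting and periodicity\<close>

definition residue_pts :: "nat \<Rightarrow> real \<Rightarrow> point set" where
  "residue_pts i a = pt i ` {u. 0 < u \<and> u < real (n i) \<and> u - a \<in> \<int>}"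

text \<open>Only an inclusion: for integral \<open>a\<close> the candidate with \<open>k\<close> = 0
  is the first vertex, which the open side omits.\<close>

lemma residue_pts_subset: "residue_pts i a \<subseteq> (\<lambda>k. pt i (frac a + real k)) ` {..<n i}"
proof
  fix x assume "x \<in> residue_pts i a"
  then obtain u :: real where u: "x = pt i u" "0 < u" "u < n i" "u - a \<in> \<int>"
    by (auto simp: residue_pts_def)
  have "(u - a) + of_int \<lfloor>a\<rfloor> \<in> \<int>" using u(4) by (intro Ints_add) auto
  then have "u - frac a \<in> \<int>" by (simp add: frac_def algebra_simps)
  then obtain l :: int where l: "u - frac a = l" by (auto elim: Ints_cases)
  have "l > - 1" "l < n i" using l u frac_lt_1[of a] frac_ge_0[of a] by linarith+
  then have "u = frac a + real (nat l)" "nat l < n i" using l by auto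
  with u(1) show "x \<in> (\<lambda>k. pt i (frac a + real k)) ` {..<n i}" by blast
qed

lemma finite_residue_pts: "finite (residue_pts i a)"
  using residue_pts_subset by (rule finite_subset) simp

lemma card_residue_pts_le: "card (residue_pts i a) \<le> n i"
  using surj_card_le[OF _ residue_pts_subset, of i a] by simp

text \<open>The unions over all naturals merely repeat the six sides, as \<open>pt\<close> and
  \<open>n\<close> have period 6.\<close>

definition residue_chords :: "real \<Rightarrow> real \<Rightarrow> chord set" where
  "residue_chords a b = phase_space P \<inter> (\<Union>i. residue_pts i a) \<times> (\<Union>i. residue_pts i b)"

lemma residue_ptsD:
  fixes u :: real
  assumes "pt i u \<in> (\<Union>i. residue_pts i a)" "0 \<le> u" "u \<le> n i"
  shows "u - a \<in> \<int> \<and> 0 < u \<and> u < n i"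
proof -
  from assms obtain i' and u' :: real where *: "pt i' u' = pt i u" "0 < u'" "u' < n i'" "u' - a \<in> \<int>"
    by (auto simp: residue_pts_def)
  then have "i' mod 6 = i mod 6 \<and> u' = u" using side_interior_pt_unique assms by blast
  with * n_cong[of i' i] show ?thesis by auto
qed

lemma residue_chords_subset:
  "residue_chords a b \<subseteq> (\<Union>j<6. \<Union>d\<in>{4, 5}. residue_pts (j + d) a \<times> residue_pts j b)"
proof
  fix c assume c: "c \<in> residue_chords a b"
  then have "c \<in> phase_space P" by (simp add: residue_chords_def)
  then obtain j d and u v :: real where 1: "j < 6" "d \<in> {4, 5}" "0 < u" "u < n (j + d)" "0 < v" "v < n j"
    "c = (pt (j + d) u, pt j v)" by (rule phase_space_cases)
  with c have "u - a \<in> \<int>" "v - b \<in> \<int>"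
    using residue_ptsD[of "j + d" u a] residue_ptsD[of j v b] by (auto simp: residue_chords_def)
  with 1 have "c \<in> residue_pts (j + d) a \<times> residue_pts j b" by (auto simp: residue_pts_def)
  with 1 show "c \<in> (\<Union>j<6. \<Union>d\<in>{4, 5}. residue_pts (j + d) a \<times> residue_pts j b)" by blast
qed

lemma finite_residue_chords: "finite (residue_chords a b)"
  by (rule finite_subset[OF residue_chords_subset]) (auto simp: finite_residue_pts)

text \<open>Each head side \<open>j\<close> admits the two tail sides \<open>j + 4\<close> and
  \<open>j + 5\<close>, which gives twelve products of side lengths.\<close>

lemma card_residue_chords_le:
  "card (residue_chords a b) \<le> (\<Sum>j<6. \<Sum>d\<in>{4, 5}. n (j + d) * n j)"
proof -
  let ?S = "\<lambda>j d. residue_pts (j + d) a \<times> residue_pts j b"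
  have "card (residue_chords a b) \<le> card (\<Union>j<6. \<Union>d\<in>{4, 5}. ?S j d)"
    by (rule card_mono[OF _ residue_chords_subset]) (auto simp: finite_residue_pts)
  also have "\<dots> \<le> (\<Sum>j<6. card (\<Union>d\<in>{4, 5}. ?S j d))"
    by (rule card_UN_le) simp
  also have "\<dots> \<le> (\<Sum>j<6. \<Sum>d\<in>{4, 5}. card (?S j d))"
    by (intro sum_mono card_UN_le) simp
  also have "\<dots> \<le> (\<Sum>j<6. \<Sum>d\<in>{4, 5}. n (j + d) * n j)"
    by (intro sum_mono) (simp add: card_cartesian_product card_residue_pts_le mult_le_mono)
  finally show ?thesis .
qed

text \<open>The old head becomes the tail, and the new head has coordinate \<open>w\<close> with
  \<open>u + w\<close> integral. That the image lies in the phase space ensures that the new head is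
  not a vertex.\<close>

lemma symplectic_billiard_residue_chords:
  assumes c: "c \<in> residue_chords a b" and Tc: "symplectic_billiard P c \<in> phase_space P"
  shows "symplectic_billiard P c \<in> residue_chords b (- a)"
proof -
  from c have "c \<in> phase_space P" by (simp add: residue_chords_def)
  then obtain j d and u v :: real where 1: "d \<in> {4, 5}" "0 < u" "u < n (j + d)" "j < 6" "0 < v" "v < n j"
    "c = (pt (j + d) u, pt j v)" by (rule phase_space_cases)
  obtain k and w :: real where 2: "0 \<le> w" "w \<le> n k" "u + w \<in> \<int>" "symplectic_billiard P c = (pt j v, pt k w)"
    by (rule symplectic_billiard_step[OF 1(1-6), folded 1(7)]) (rule that)
  from Tc obtain i d' and t u' :: real where "0 < u'" "u' < n i"
    "symplectic_billiard P c = (pt (i + d') t, pt i u')" by (rule phase_space_cases)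
  with 2(4) have z: "pt i u' = pt k w" "0 < u'" "u' < n i" by simp_all
  \<comment> \<open>Comparison with the coordinate supplied by the phase space turns the weak bounds
    on \<open>w\<close> into strict ones.\<close>
  then have "i mod 6 = k mod 6 \<and> u' = w" using side_interior_pt_unique 2(1,2) by metis
  then have w: "0 < w" "w < n k" using z n_cong[of i k] by auto
  have "u - a \<in> \<int>" using residue_ptsD[of "j + d" u a] c 1 by (auto simp: residue_chords_def)
  then have "(u + w) - (u - a) \<in> \<int>" by (rule Ints_diff[OF 2(3)])
  then have "w - (- a) \<in> \<int>" by simp
  then have "pt k w \<in> residue_pts k (- a)" using w by (auto simp: residue_pts_def)
  with c Tc 1(7) 2(4) show ?thesis by (auto simp: residue_chords_def)
qed

lemma periodic_if_forward_orbit: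
  assumes orbit: "\<And>k. (symplectic_billiard P ^^ k) c \<in> phase_space P"
  shows "periodic_point (symplectic_billiard P) c \<and>
    period (symplectic_billiard P) c \<le> 4 * (\<Sum>j<6. \<Sum>d\<in>{4, 5}. n (j + d) * n j)"
proof -
  let ?T = "symplectic_billiard P"
  define N where "N = (\<Sum>j<6. \<Sum>d\<in>{4, 5}. n (j + d) * n j)"
  have "c \<in> phase_space P" using orbit[of 0] by simp
  then obtain j d and u v :: real where 1: "d \<in> {4, 5}" "0 < u" "u < n (j + d)" "j < 6" "0 < v" "v < n j"
    "c = (pt (j + d) u, pt j v)" by (rule phase_space_cases)
  have res: "(?T ^^ (4 * k)) c \<in> residue_chords u v" for k
  proof (induction k)
    case 0
    have "pt (j + d) u \<in> residue_pts (j + d) u" "pt j v \<in> residue_pts j v"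
      using 1 by (auto simp: residue_pts_def)
    with \<open>c \<in> phase_space P\<close> 1(7) show ?case by (auto simp: residue_chords_def)
  next
    case (Suc k)
    have step: "(?T ^^ m) c \<in> residue_chords a b \<Longrightarrow> (?T ^^ Suc m) c \<in> residue_chords b (- a)" for m a b
      using symplectic_billiard_residue_chords orbit[of "Suc m"] by simp
    \<comment> \<open>The residues run through \<open>(u, v)\<close>, \<open>(v, - u)\<close>,
      \<open>(- u, - v)\<close>, \<open>(- v, u)\<close> and back to \<open>(u, v)\<close>.\<close>
    from step[OF step[OF step[OF step[OF Suc]]]] show ?case by (simp add: numeral_eq_Suc)
  qed
  \<comment> \<open>The \<open>N + 1\<close> indices from 0 to \<open>N\<close> are mapped into a
    set of at most \<open>N\<close> chords.\<close>
  have *: "\<not> inj_on (\<lambda>k. (?T ^^ (4 * k)) c) {..N}"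
  proof (rule pigeonhole)
    have "card ((\<lambda>k. (?T ^^ (4 * k)) c) ` {..N}) \<le> card (residue_chords u v)"
      by (rule card_mono[OF finite_residue_chords]) (use res in auto)
    also have "\<dots> \<le> N" unfolding N_def by (rule card_residue_chords_le)
    finally show "card ((\<lambda>k. (?T ^^ (4 * k)) c) ` {..N}) < card {..N}" by simp
  qed
  obtain k l where kl: "k < l" "l \<le> N" "(?T ^^ (4 * k)) c = (?T ^^ (4 * l)) c"
  proof -
    from * obtain i m where "i \<le> N" "m \<le> N" "i \<noteq> m" "(?T ^^ (4 * i)) c = (?T ^^ (4 * m)) c"
      by (auto simp: inj_on_def)
    then show thesis by (cases "i < m") (auto intro: that[of i m] that[of m i])
  qed
  \<comment> \<open>Injectivity moves a coincidence of two iterates back to the starting chord, so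
    the orbit is purely periodic.\<close>
  have cancel: "(?T ^^ i) c = c" if "(?T ^^ m) c = (?T ^^ (m + i)) c" for m i
    using that
  proof (induction m)
    case (Suc m)
    then have "?T ((?T ^^ m) c) = ?T ((?T ^^ (m + i)) c)" by simp
    then have "(?T ^^ m) c = (?T ^^ (m + i)) c"
      using inj_onD[OF symplectic_billiard_inj_on] orbit by blast
    then show ?case by (rule Suc.IH)
  qed simp
  have "(?T ^^ (4 * (l - k))) c = c"
    using kl cancel[of "4 * k" "4 * (l - k)"] by (simp add: algebra_simps)
  moreover have "4 * (l - k) > 0" "4 * (l - k) \<le> 4 * N" using kl by auto
  ultimately show ?thesis
    unfolding periodic_point_def period_def N_def[symmetric]
    by (blast intro: order_trans[OF Least_le])
qed

section \<open>Lattice points on a side and its elementary segments\<close>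

lemma pt_lattice_iff: "pt i u \<in> lattice \<longleftrightarrow> u \<in> \<int>"
proof
  assume "pt i u \<in> lattice"
  then have "pt i u - vertex P i \<in> lattice" using lattice_diff vertex_lattice by blast
  \<comment> \<open>As \<open>e i\<close> and \<open>e (i + 1)\<close> have determinant 1, this
    bracket equals \<open>u\<close>.\<close>
  then have "bracket (pt i u - vertex P i) (e (i + 1)) \<in> \<int>" using bracket_Ints e_lattice by blast
  then show "u \<in> \<int>" using bracket_e_1[of i] by (simp add: pt_def bracket_simps)
next
  assume "u \<in> \<int>"
  then show "pt i u \<in> lattice"
    unfolding pt_def using lattice_add lattice_scaleR vertex_lattice e_lattice by blast
qed

text \<open>The lattice points of the side have coordinates 0 to \<open>n i\<close>, and a segment
  between two of them has no lattice point inside exactly when they are consecutive.\<close>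

lemma card_elementary_segments: "card (elementary_segments P i) = n i"
proof -
  let ?seg = "\<lambda>k. closed_segment (pt i (real k)) (pt i (real (Suc k)))"
  have lat: "side P i \<inter> lattice = pt i ` real ` {..n i}"
  proof -
    have "\<exists>k\<le>n i. u = real k" if "u \<in> \<int>" "0 \<le> u" "u \<le> n i" for u :: real
      using that by (metis Ints_cases of_int_0_le_iff of_nat_le_iff of_nat_nat)
    then show ?thesis by (fastforce simp: side_eq pt_lattice_iff)
  qed
  have "elementary_segments P i = ?seg ` {..<n i}"
  proof (intro equalityI subsetI)
    fix s assume "s \<in> ?seg ` {..<n i}"
    then obtain k where k: "k < n i" "s = ?seg k" by blast
    have "pt i (real k) \<in> side P i \<inter> lattice" "pt i (real (Suc k)) \<in> side P i \<inter> lattice"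
      unfolding lat using k by (auto simp: Suc_le_eq simp del: of_nat_Suc)
    moreover have "open_segment (pt i (real k)) (pt i (real (Suc k))) \<inter> lattice = {}"
    proof -
      have "u \<notin> \<int>" if u: "real k < u" "u < real (Suc k)" for u
      proof
        assume "u \<in> \<int>"
        then obtain z where "u = of_int z" by (rule Ints_cases)
        with u have "int k < z" "z < int k + 1" by linarith+
        then show False by simp
      qed
      then show ?thesis by (auto simp: open_segment_pt pt_lattice_iff simp del: of_nat_Suc)
    qed
    moreover have "pt i (real k) \<noteq> pt i (real (Suc k))" by simp
    ultimately show "s \<in> elementary_segments P i"
      unfolding elementary_segments_def using k(2) by blast
  next
    fix s assume "s \<in> elementary_segments P i"
    then obtain a b where ab: "s = closed_segment a b" "a \<in> pt i ` real ` {..n i}"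
      "b \<in> pt i ` real ` {..n i}" "a \<noteq> b" "open_segment a b \<inter> lattice = {}"
      unfolding elementary_segments_def lat by blast
    then obtain k l where "a = pt i (real k)" "b = pt i (real l)" "k \<le> n i" "l \<le> n i" by auto
    with ab have kl: "s = closed_segment (pt i (real k)) (pt i (real l))" "k \<noteq> l"
      "k \<le> n i" "l \<le> n i" "open_segment (pt i (real k)) (pt i (real l)) \<inter> lattice = {}"
      by auto
    have consecutive: "l = Suc k" if "k < l" "open_segment (pt i (real k)) (pt i (real l)) \<inter> lattice = {}" for k l
    proof (rule ccontr)
      assume "l \<noteq> Suc k"
      with \<open>k < l\<close> have "real k < real (Suc k)" "real (Suc k) < real l" by auto
      then have "pt i (real (Suc k)) \<in> open_segment (pt i (real k)) (pt i (real l)) \<inter> lattice"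
        by (auto simp: open_segment_pt pt_lattice_iff)
      with that(2) show False by blast
    qed
    show "s \<in> ?seg ` {..<n i}"
    proof (cases "k < l")
      case True
      then have "l = Suc k" using consecutive kl(5) by blast
      with kl show ?thesis by (auto simp del: of_nat_Suc)
    next
      case False
      then have "k = Suc l" using consecutive[of l k] kl(2,5) by (simp add: open_segment_commute)
      with kl show ?thesis by (auto simp: closed_segment_commute simp del: of_nat_Suc)
    qed
  qed
  moreover have "inj_on ?seg {..<n i}"
    by (auto simp: inj_on_def doubleton_eq_iff)
  ultimately show ?thesis by (simp add: card_image)
qed

end

section \<open>Recovering the coordinates from slopes and convexity\<close>

text \<open>The six directions of slope 0, 1 and infinity in counterclockwise order; the sequence has
  period 6.\<close>

fun hex_dir :: "nat \<Rightarrow> point" where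
  "hex_dir 0 = (1, 0)"
| "hex_dir (Suc 0) = (1, 1)"
| "hex_dir (Suc (Suc i)) = hex_dir (Suc i) - hex_dir i"

interpretation hex_dir: hexagonal_directions hex_dir
  by unfold_locales (simp_all add: bracket_def)

lemma hex_dir_lattice: "hex_dir i \<in> lattice"
  by (induction i rule: hex_dir.induct) (auto simp: lattice_iff)

text \<open>The index \<open>k\<close> matters only modulo 6, so it can grow along with the side
  index. The factor is real; its integrality is shown later.\<close>

definition pos_multiple :: "point \<Rightarrow> nat \<Rightarrow> bool" where
  "pos_multiple v k \<longleftrightarrow> (\<exists>t>0. v = t *\<^sub>R hex_dir k)"

lemma pos_multiple_if_slope:
  assumes "slope v \<in> {0, 1, \<infinity>}" "v \<noteq> 0"
  shows "\<exists>k. pos_multiple v k"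
proof -
  obtain x y where v: "v = (x, y)" by fastforce
  with assms consider "x \<noteq> 0" "y = 0" | "x = y" "x \<noteq> 0" | "x = 0" "y \<noteq> 0"
    by (auto simp: slope_def zero_ereal_def one_ereal_def zero_prod_def split: if_splits)
  then have "v = \<bar>x\<bar> *\<^sub>R hex_dir 0 \<and> x \<noteq> 0 \<or> v = \<bar>x\<bar> *\<^sub>R hex_dir 3 \<and> x \<noteq> 0 \<or>
    v = \<bar>x\<bar> *\<^sub>R hex_dir 1 \<and> x \<noteq> 0 \<or> v = \<bar>x\<bar> *\<^sub>R hex_dir 4 \<and> x \<noteq> 0 \<or>
    v = \<bar>y\<bar> *\<^sub>R hex_dir 2 \<and> y \<noteq> 0 \<or> v = \<bar>y\<bar> *\<^sub>R hex_dir 5 \<and> y \<noteq> 0"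
    by cases (auto simp: v eval_nat_numeral abs_if)
  then show ?thesis unfolding pos_multiple_def by (metis zero_less_abs_iff)
qed

text \<open>A positive determinant means a counterclockwise turn by less than a half turn, hence by
  one or two of the six directions.\<close>

lemma pos_multiple_bracket_pos:
  assumes v: "pos_multiple v k" and w: "pos_multiple w l" and "bracket v w > 0"
  shows "pos_multiple w (k + 1) \<or> pos_multiple w (k + 2)"
proof -
  obtain m where m: "m < 6" "(k + m) mod 6 = l mod 6" by (rule mod6_less_cases)
  then have eq: "hex_dir l = hex_dir (k + m)" by (metis hex_dir.e_mod)
  have "bracket (hex_dir k) (hex_dir (k + m)) > 0"
    using assms by (auto simp: pos_multiple_def bracket_simps zero_less_mult_iff eq)
  with m(1) have "m = 1 \<or> m = 2"
    using hex_dir.bracket_e_1[of k]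
    by (cases rule: less_6_cases)
      (auto simp: hex_dir.e_3 hex_dir.e_shift bracket_simps
        simp del: One_nat_def add_Suc_right add_2_eq_Suc' add_2_eq_Suc)
  with w show ?thesis unfolding pos_multiple_def eq by auto
qed

text \<open>Meant for three successive sides. If \<open>w\<close> skipped direction
  \<open>k + 1\<close>, then \<open>x\<close>, which is at most two directions past
  \<open>v\<close>, could not lie counterclockwise of \<open>w\<close>.\<close>

lemma pos_multiple_Suc:
  assumes "pos_multiple v k" "pos_multiple w l" "pos_multiple x l'"
    and "bracket v w > 0" "bracket w x > 0" "bracket v x > 0"
  shows "pos_multiple w (Suc k)"
proof (rule ccontr)
  assume "\<not> pos_multiple w (Suc k)"
  then have w: "pos_multiple w (k + 2)" using pos_multiple_bracket_pos assms(1,2,4) by fastforce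
  have "bracket (hex_dir (k + 2)) (hex_dir (k + 1)) = - 1"
    using hex_dir.bracket_e_1[of "k + 1"] bracket_commute[of "hex_dir (k + 2)" "hex_dir (k + 1)"]
    by (simp add: add.assoc)
  moreover have "pos_multiple x (k + 1) \<or> pos_multiple x (k + 2)"
    using pos_multiple_bracket_pos assms(1,3,6) by blast
  ultimately have "bracket w x \<le> 0"
    using w by (auto simp: pos_multiple_def bracket_simps simp del: hex_dir.simps)
  with assms(5) show False by simp
qed

theorem theorem5p1:
  fixes P :: "(real \<times> real) list" and p1 q1 r1 p2 q2 r2 N :: nat
  assumes "length P = 6" and "convex_polygon P"
    and "set P \<subseteq> lattice"
    and "\<And>i. i < 3 \<Longrightarrow> bracket (side_vec P i) (side_vec P (i + 3)) = 0"
    and "(\<lambda>i. slope (side_vec P i)) ` {..<6} = {0, 1, \<infinity>}"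
    and "p1 = card (elementary_segments P 0)"
    and "q1 = card (elementary_segments P 1)"
    and "r1 = card (elementary_segments P 2)"
    and "p2 = card (elementary_segments P 3)"
    and "q2 = card (elementary_segments P 4)"
    and "r2 = card (elementary_segments P 5)"
    and "N = p1 * q1 + q1 * r1 + r1 * p2 + p2 * q2 + q2 * r2 + r2 * p1
           + p1 * r1 + q1 * p2 + r1 * q2 + p2 * r2 + q2 * p1 + r2 * q1"
  shows "\<forall>c. has_full_orbit P c \<longrightarrow>
           periodic_point (symplectic_billiard P) c \<and> period (symplectic_billiard P) c \<le> 4 * N"
proof -
  let ?V = "vertex P" and ?s = "side_vec P"
  have V_mod: "?V (i mod 6) = ?V i" for i
    by (simp add: vertex_def assms(1))
  have s_cong: "?s i = ?s j" if "i mod 6 = j mod 6" for i j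
  proof -
    have "Suc i mod 6 = Suc j mod 6" using that by (metis mod_Suc_eq)
    then show ?thesis using that by (simp add: side_vec_def vertex_def assms(1))
  qed
  have left: "bracket (?s i) (?V (i + m) - ?V i) > 0" if "m \<in> {2, 3}" for i m
  proof -
    have "i mod 6 < 6" by simp
    then have "(i mod 6 + m) mod 6 \<noteq> i mod 6 \<and> (i mod 6 + m) mod 6 \<noteq> Suc (i mod 6) mod 6"
      using that by (cases rule: less_6_cases) auto
    then have "(i + m) mod 6 \<noteq> i mod 6" "(i + m) mod 6 \<noteq> Suc (i mod 6) mod 6"
      by (simp_all add: mod_add_left_eq)
    moreover have "\<forall>i<6. \<forall>j<6. j \<noteq> i \<and> j \<noteq> Suc i mod 6 \<longrightarrow> bracket (?s i) (?V j - ?V i) > 0"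
      using assms(1,2) by (simp add: convex_polygon_def)
    ultimately have "bracket (?s (i mod 6)) (?V ((i + m) mod 6) - ?V (i mod 6)) > 0" by simp
    then show ?thesis using s_cong[of "i mod 6" i] by (simp add: V_mod)
  qed
  have adjacent: "bracket (?s i) (?s (i + 1)) > 0" for i
  proof -
    have "?V (i + 2) - ?V i = ?s i + ?s (i + 1)" by (simp add: side_vec_def)
    then show ?thesis using left[of 2 i] by (simp add: bracket_simps)
  qed
  have nonzero: "?s i \<noteq> 0" for i using adjacent[of i] by (auto simp: bracket_simps)
  have parallel: "bracket (?s i) (?s (i + 3)) = 0" for i
  proof (cases "i mod 6 < 3")
    case True
    have "?s (i mod 6) = ?s i" "?s (i mod 6 + 3) = ?s (i + 3)"
      by (rule s_cong; simp add: mod_add_left_eq)+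
    with assms(4)[OF True] show ?thesis by simp
  next
    case False
    then have "(i + 3) mod 6 < 3" by presburger
    moreover have "?s ((i + 3) mod 6) = ?s (i + 3)" "?s ((i + 3) mod 6 + 3) = ?s i"
      by (rule s_cong; simp add: mod_add_left_eq)+
    ultimately show ?thesis using assms(4)[of "(i + 3) mod 6"] bracket_commute[of "?s i" "?s (i + 3)"] by simp
  qed
  \<comment> \<open>Opposite sides are antiparallel: in \<open>?s (i + 3) = l *\<^sub>R ?s i\<close>
    the factor is negative, because each of the two sides has a vertex of the other on its left. The
    sign then follows from the turn between sides \<open>i + 2\<close> and
    \<open>i + 3\<close>.\<close>
  have next_but_one: "bracket (?s i) (?s (i + 2)) > 0" for i
  proof -
    obtain l where l: "?s (i + 3) = l *\<^sub>R ?s i"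
    proof -
      obtain a b c d where ab: "?s i = (a, b)" "?s (i + 3) = (c, d)" by fastforce
      have "(c, d) = (c / a) *\<^sub>R (a, b) \<or> (c, d) = (d / b) *\<^sub>R (a, b)"
        using parallel[of i] nonzero[of i] unfolding ab
        by (auto simp: bracket_def zero_prod_def field_simps)
      with that ab show thesis by metis
    qed
    have "?V (i + 3 + 3) = ?V i" using V_mod[of "i + 6"] V_mod[of i] by (simp add: add.assoc)
    then have "bracket (?s (i + 3)) (?V i - ?V (i + 3)) > 0" using left[of 3 "i + 3"] by simp
    then have "l * bracket (?s i) (?V (i + 3) - ?V i) < 0"
      unfolding l by (simp add: bracket_simps algebra_simps)
    then have "l < 0" using left[of 3 i] by (simp add: mult_less_0_iff)
    have "bracket (?s (i + 2)) (?s (i + 3)) > 0" using adjacent[of "i + 2"] by (simp add: eval_nat_numeral)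
    then have "l * bracket (?s i) (?s (i + 2)) < 0"
      unfolding l using bracket_commute[of "?s i" "?s (i + 2)"] by (simp add: bracket_simps)
    then show ?thesis using \<open>l < 0\<close> by (simp add: mult_less_0_iff)
  qed
  have direction: "\<exists>k. pos_multiple (?s i) k" for i
  proof (rule pos_multiple_if_slope[OF _ nonzero])
    have "slope (?s (i mod 6)) \<in> (\<lambda>i. slope (?s i)) ` {..<6}" by simp
    then show "slope (?s i) \<in> {0, 1, \<infinity>}"
      unfolding assms(5) using s_cong[of "i mod 6" i] by simp
  qed
  \<comment> \<open>The first side has direction \<open>r\<close>, and each further side advances by
    exactly one direction.\<close>
  obtain r where "pos_multiple (?s 0) r" using direction by blast
  then have "pos_multiple (?s i) (r + i)" for i
  proof (induction i)
    case (Suc i)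
    obtain k k' where "pos_multiple (?s (i + 1)) k" "pos_multiple (?s (i + 2)) k'"
      using direction by blast
    then have "pos_multiple (?s (i + 1)) (Suc (r + i))"
      using pos_multiple_Suc[OF Suc.IH[OF Suc.prems]] adjacent[of i] adjacent[of "i + 1"] next_but_one[of i]
      by (simp add: add.assoc)
    then show ?case by simp
  qed simp
  then obtain t where t: "\<And>i. t i > 0" "\<And>i. ?s i = t i *\<^sub>R hex_dir (r + i)"
    unfolding pos_multiple_def by metis
  have V_lattice: "?V i \<in> lattice" for i
    using assms(1,3) nth_mem[of "i mod 6" P] by (auto simp: vertex_def)
  \<comment> \<open>The length factor is a determinant of two lattice vectors.\<close>
  have "t i \<in> \<int>" for i
  proof -
    have "bracket (?s i) (hex_dir (r + i + 1)) = t i"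
      using hex_dir.bracket_e_1[of "r + i"] by (simp add: t(2) bracket_simps)
    moreover have "?s i \<in> lattice" unfolding side_vec_def by (intro lattice_diff V_lattice)
    ultimately show ?thesis using bracket_Ints hex_dir_lattice by metis
  qed
  define n where "n = (\<lambda>i. nat \<lfloor>t i\<rfloor>)"
  have n: "real (n i) = t i" for i
    using \<open>t i \<in> \<int>\<close> t(1)[of i] by (auto simp: n_def elim!: Ints_cases)
  interpret lattice_hexagon "\<lambda>i. hex_dir (r + i)" P n
  proof
    show "bracket (hex_dir (r + 0)) (hex_dir (r + 1)) = 1" using hex_dir.bracket_e_1[of r] by simp
    show "vertex P (Suc i) = vertex P i + real (n i) *\<^sub>R hex_dir (r + i)" for i
      using t(2)[of i] by (simp add: n side_vec_def algebra_simps)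
    show "n i > 0" for i using n[of i] t(1)[of i] by simp
  qed (simp_all add: assms(1) V_lattice hex_dir_lattice)
  \<comment> \<open>The index \<open>j + d\<close> reaches 10. Reduced modulo 6, the twelve summands
    are the pairs of sides at cyclic distance 1 or 2, which are the terms of
    \<open>N\<close>.\<close>
  have "n 6 = n 0" "n 7 = n 1" "n 8 = n 2" "n 9 = n 3" "n 10 = n 4"
    using n_cong[of 6 0] n_cong[of 7 1] n_cong[of 8 2] n_cong[of 9 3] n_cong[of 10 4] by simp_all
  then have N: "(\<Sum>j<6. \<Sum>d\<in>{4, 5}. n (j + d) * n j) = N"
    by (simp add: assms(6-12) card_elementary_segments lessThan_nat_numeral numeral_eq_Suc)
  show ?thesis
  proof (intro allI impI)
    fix c assume "has_full_orbit P c"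
    then obtain \<sigma> :: "int \<Rightarrow> chord" where \<sigma>: "\<sigma> 0 = c" "\<And>k. \<sigma> k \<in> phase_space P"
      "\<And>k. symplectic_billiard P (\<sigma> k) = \<sigma> (k + 1)"
      unfolding has_full_orbit_def by auto
    have "(symplectic_billiard P ^^ k) c = \<sigma> (int k)" for k
    proof (induction k)
      case (Suc k)
      then show ?case using \<sigma>(3)[of "int k"] by (simp add: add.commute)
    qed (simp add: \<sigma>(1))
    then have "(symplectic_billiard P ^^ k) c \<in> phase_space P" for k using \<sigma>(2) by simp
    then show "periodic_point (symplectic_billiard P) c \<and> period (symplectic_billiard P) c \<le> 4 * N"
      using periodic_if_forward_orbit unfolding N by simp
  qed
qed

end
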